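(* The sequence $(C_n)_{n\ge0}$ of Catalan numbers is log-convex, i.e. $C_n^2\le C_{n-1}C_{n+1}$ for all $n\ge1$.
   Context: The $n$th Catalan number is $C_n=\frac{1}{n+1}\binom{2n}{n}$; equivalently, the number of Dyck paths of semilength $n$ (lattice paths from $(0,0)$ to $(2n,0)$ using steps $[1,1]$ and $[1,-1]$ and never going below the $x$-axis). *)

theory Defs
  imports Complex_Main
begin

definition catalan :: "nat \<Rightarrow> real" where
  "catalan n = 1 / (real n + 1) * real ((2 * n) choose n)"

definition log_convex :: "(nat \<Rightarrow> real) \<Rightarrow> bool" where
  "log_convex a \<longleftrightarrow> (\<forall>n\<ge>1. (a n)\<^sup>2 \<le> a (n - 1) * a (n + 1))"

end

theory Submission imports Defs begin

text \<open>
  A positive sequence is log-convex exactly when its ratios of consecutive terms increase. For the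
  Catalan numbers the ratio is explicit, \<open>C\<^sub>n\<^sub>+\<^sub>1 / C\<^sub>n = 2 (2 n + 1) / (n + 2) = 4 - 6 / (n + 2)\<close>
  (lemma \<open>catalan_Suc\<close>), and the last form visibly increases with \<open>n\<close>.
\<close>

lemma catalan_nonneg: "0 \<le> catalan n"
  by (simp add: catalan_def)

text \<open>
  The ratio is written as \<open>4 - 6 / (n + 2)\<close> because its monotonicity in \<open>n\<close> is then immediate. The
  recurrence holds because passing from \<open>n\<close> to \<open>n + 1\<close> multiplies \<open>(2 n)!\<close> by
  \<open>(2 n + 2) (2 n + 1)\<close> and \<open>(n!)\<^sup>2\<close> by \<open>(n + 1)\<^sup>2\<close>.
\<close>

lemma catalan_Suc: "catalan (Suc n) = (4 - 6 / (real n + 2)) * catalan n"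
proof -
  have closed: "catalan k = fact (2 * k) / ((real k + 1) * (fact k * fact k))" for k
    by (simp add: catalan_def binomial_fact)
  have "catalan (Suc n) = (2 * real n + 2) * (2 * real n + 1) * fact (2 * n) /
      ((real n + 2) * ((real n + 1) * fact n * ((real n + 1) * fact n)))"
    unfolding closed by (simp add: algebra_simps)
  also have "\<dots> = 2 * (2 * real n + 1) / (real n + 2) * catalan n"
    unfolding closed by (simp add: divide_simps) (simp add: algebra_simps)
  also have "2 * (2 * real n + 1) / (real n + 2) = 4 - 6 / (real n + 2)"
    by (simp add: field_simps)
  finally show ?thesis .
qed

theorem theorem2p1: "log_convex catalan"
  unfolding log_convex_def
proof (intro allI impI)
  fix n :: nat
  assume "n \<ge> 1"
  then obtain m where n: "n = Suc m"
    by (cases n) auto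
  have ratio_le: "4 - 6 / (real m + 2) \<le> 4 - 6 / (real n + 2)"
    by (simp add: n frac_le)
  have "(catalan n)\<^sup>2 = (4 - 6 / (real m + 2)) * (catalan m * catalan n)"
    by (simp add: n power2_eq_square catalan_Suc[of m])
  also have "\<dots> \<le> (4 - 6 / (real n + 2)) * (catalan m * catalan n)"
    using ratio_le by (intro mult_right_mono) (simp_all add: catalan_nonneg)
  also have "\<dots> = catalan (n - 1) * catalan (n + 1)"
    using catalan_Suc[of n] by (simp add: n)
  finally show "(catalan n)\<^sup>2 \<le> catalan (n - 1) * catalan (n + 1)" .
qed

end
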